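(* Let $d>3$ be a prime such that $-1$ is a quadratic nonresidue modulo $d$ and $2$ is a quadratic nonresidue modulo $d$. Then the equation $$d=\left(\frac{k}{2j}\right)^2\frac{m^2-e^2}{em}$$ has no solutions $k,j,m,e\in\mathbb{N}$ with $\gcd(m,e)=1$, $\gcd(k,j)=1$ and $m>e>0$.
   Context: For a prime $p>2$, $x\in\{1,\dots,p-1\}$ is a quadratic residue modulo $p$ if there is $y\in\{1,\dots,p-1\}$ with $y^2\equiv x \pmod p$, and a quadratic nonresidue otherwise; $-1$ is interpreted as the residue class $p-1$. *)

theory Defs
  imports Complex_Main "HOL-Number_Theory.Number_Theory"
begin

end

theory Submission
  imports Defs "HOL-Computational_Algebra.Nth_Powers"
begin

text \<open>
  The equation forces $e m (m^2 - e^2)$ to be $d$ times a square, that is, $d$ to be a congruent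
  number. After the substitution $m = u + v$, $e = u - v$ if $m$ and $e$ are both odd, the factors
  $e$, $m$, $m - e$, $m + e$ are pairwise coprime, so three are squares and one is $d$ times a
  square. If this one is $m$ or $m + e$, then $-1$ is a residue; if it is $m - e$, then $2$ is a
  residue. If it is $e$, the square roots of $m \pm e$ give a primitive Pythagorean triple with
  hypotenuse $\sqrt m$ whose area is $d$ times a square, and its parametrisation is a smaller
  solution.
\<close>

section \<open>Nonresidues and forms x^2 - c y^2\<close>

text \<open>If \<open>p\<close> did not divide \<open>y\<close>, then \<open>y\<close> would be
  invertible modulo \<open>p\<close> and x/y would be a square root of \<open>c\<close>. Below, c =
  -1 and c = 2 are used to rule out every position of the prime \<open>d\<close> except the one
  handled by descent.\<close>

lemma nonresidue_dvd:
  fixes p c x y :: int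
  assumes p: "prime p" and c: "\<not> QuadRes p c" and dvd: "p dvd x\<^sup>2 - c * y\<^sup>2"
  shows "p dvd x \<and> p dvd y"
proof -
  have y: "p dvd y"
  proof (rule ccontr)
    assume "\<not> p dvd y"
    then have "coprime y p"
      using p by (simp add: coprime_commute prime_imp_coprime)
    then obtain w where w: "[y * w = 1] (mod p)"
      using cong_solve_coprime_int by blast
    have "[x\<^sup>2 = c * y\<^sup>2] (mod p)"
      using dvd by (simp add: cong_iff_dvd_diff)
    then have "[x\<^sup>2 * w\<^sup>2 = c * y\<^sup>2 * w\<^sup>2] (mod p)"
      by (rule cong_scalar_right)
    then have "[(x * w)\<^sup>2 = c * (y * w)\<^sup>2] (mod p)"
      by (simp only: power_mult_distrib mult.assoc)
    also have "[c * (y * w)\<^sup>2 = c * 1\<^sup>2] (mod p)"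
      by (intro cong_mult cong_pow cong_refl w)
    finally have "[(x * w)\<^sup>2 = c] (mod p)"
      by simp
    then show False
      using c by (auto simp: QuadRes_def)
  qed
  then have "p dvd c * y\<^sup>2"
    by (simp add: power2_eq_square)
  from dvd_add[OF dvd this] have "p dvd x\<^sup>2"
    by simp
  with p y show ?thesis
    using prime_dvd_power by blast
qed

section \<open>Coprime factors of squares and of \<open>d\<close> times squares\<close>

lemma coprime_add_self_right_iff: "coprime a (a + b) \<longleftrightarrow> coprime a b" for a b :: nat
  by (simp only: coprime_iff_gcd_eq_1 gcd_add2)

lemma coprime_mult_eq_square:
  fixes a b z :: nat
  assumes "coprime a b" and "a * b = z\<^sup>2"
  obtains x y where "a = x\<^sup>2" and "b = y\<^sup>2"
proof -
  have "is_nth_power 2 (a * b)"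
    using assms(2) by (metis is_nth_powerI)
  then have "is_nth_power 2 a" "is_nth_power 2 b"
    using is_nth_power_mult_coprime_nat_iff[OF assms(1), of 2] by auto
  then show ?thesis
    using that by (auto simp: is_nth_power_def)
qed

text \<open>The prime \<open>d\<close> divides one of the factors; dividing it out leaves two
  coprime numbers whose product is a square.\<close>

lemma coprime_mult_eq_prime_square:
  fixes a b d z :: nat
  assumes d: "prime d" and cop: "coprime a b" and eq: "a * b = d * z\<^sup>2"
  shows "(\<exists>x y. a = d * x\<^sup>2 \<and> b = y\<^sup>2) \<or> (\<exists>x y. a = x\<^sup>2 \<and> b = d * y\<^sup>2)"
proof -
  have *: "\<exists>x y. a = d * x\<^sup>2 \<and> b = y\<^sup>2"
    if "coprime a b" "a * b = d * z\<^sup>2" "d dvd a" for a b :: nat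
  proof -
    from that(3) obtain a' where a': "a = d * a'" ..
    with that(2) d have "a' * b = z\<^sup>2"
      by (simp add: prime_gt_0_nat)
    moreover have "coprime a' b"
      using that(1) a' by simp
    ultimately show ?thesis
      using a' by (metis coprime_mult_eq_square)
  qed
  have "d dvd a * b"
    using eq by simp
  then have "d dvd a \<or> d dvd b"
    using d prime_dvd_multD by blast
  then show ?thesis
    using *[of a b] *[of b a] cop eq by (auto simp: coprime_commute mult.commute)
qed

section \<open>Pythagorean triples and the descent step\<close>

text \<open>With s = 2t and a = r + 2h, the equation s^2 = (a - r)(a + r) becomes t^2 = h(r + h). A
  common prime of the two factors would divide both \<open>r\<close> and \<open>s\<close>, so the
  factors are coprime and hence squares, \<open>Q\<^sup>2\<close> and
  \<open>P\<^sup>2\<close>.\<close>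

lemma primitive_Pythagorean_triple:
  fixes r s a :: nat
  assumes cop: "coprime r s" and ev: "even s" and s: "s > 0" and eq: "r\<^sup>2 + s\<^sup>2 = a\<^sup>2"
  obtains P Q where "coprime P Q" "Q > 0" "odd (P + Q)" "r + Q\<^sup>2 = P\<^sup>2" "s = 2 * P * Q"
    "a = P\<^sup>2 + Q\<^sup>2"
proof -
  have r: "odd r"
    using cop ev coprime_common_divisor[of r s 2] by auto
  then have "odd (a\<^sup>2)"
    using ev by (simp flip: eq)
  then have a: "odd a"
    by simp
  have "r\<^sup>2 < a\<^sup>2"
    using s by (simp flip: eq)
  then have "r < a"
    using power_less_imp_less_base by blast
  then obtain g where "a = r + g"
    using less_imp_add_positive by blast
  moreover from this r a have "even g"
    by simp
  ultimately obtain h where h: "a = r + 2 * h"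
    by (auto elim: evenE)
  from ev obtain t where t: "s = 2 * t" ..
  have prod: "h * (r + h) = t\<^sup>2"
    using eq by (simp add: h t power2_eq_square algebra_simps)
  have "coprime h (r + h)"
  proof (rule ccontr)
    assume "\<not> coprime h (r + h)"
    then have "gcd h (r + h) \<noteq> 1"
      using coprime_iff_gcd_eq_1 by blast
    then obtain p where "prime p" "p dvd gcd h (r + h)"
      using prime_factor_nat by blast
    then have p: "prime p" "p dvd h" "p dvd r + h"
      by auto
    then have "p dvd r" "p dvd t\<^sup>2"
      using prod by (auto simp: dvd_add_left_iff simp flip: prod)
    then have "p dvd t"
      using p(1) prime_dvd_power by blast
    then have "p dvd s"
      by (simp add: t)
    with cop \<open>p dvd r\<close> have "is_unit p"
      using coprime_common_divisor by blast
    with p(1) show False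
      by (simp add: not_prime_unit)
  qed
  from this prod obtain Q P where PQ: "h = Q\<^sup>2" "r + h = P\<^sup>2"
    by (rule coprime_mult_eq_square)
  have "(P * Q)\<^sup>2 = t\<^sup>2"
    using prod PQ by (simp add: power_mult_distrib mult.commute)
  then have t': "t = P * Q"
    by simp
  show ?thesis
  proof (rule that)
    show "coprime P Q"
      using \<open>coprime h (r + h)\<close> PQ by (simp add: coprime_commute)
    show "Q > 0"
      using s t t' by simp
    have "a = P\<^sup>2 + Q\<^sup>2"
      using h PQ by simp
    then have "odd (P\<^sup>2 + Q\<^sup>2)"
      using a by simp
    then show "odd (P + Q)"
      by simp
  qed (use PQ h t t' in auto)
qed

text \<open>The squares of \<open>c\<close>, \<open>a\<close>, \<open>f\<close> are in arithmetic
  progression with difference d b^2. Half the sum and half the difference of \<open>f\<close> and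
  \<open>c\<close> are therefore the legs of a right triangle with hypotenuse \<open>a\<close> and
  area d (b/2)^2. Its parameters \<open>P\<close>, \<open>Q\<close> take the roles of m, e, and the
  bound \<open>P < a\<^sup>2\<close> makes the induction work, as a^2 will be the old m.\<close>

lemma descent_step:
  fixes a b c d f :: nat
  assumes ce: "c\<^sup>2 + d * b\<^sup>2 = a\<^sup>2" and fe: "a\<^sup>2 + d * b\<^sup>2 = f\<^sup>2"
    and c: "odd c" and b: "d * b\<^sup>2 > 0" and d: "odd d" and cop: "coprime c f"
  obtains P Q x where "coprime P Q" "0 < Q" "Q < P" "odd (P + Q)" "P < a\<^sup>2"
    "Q * P * ((P - Q) * (P + Q)) = d * x\<^sup>2"
proof -
  have "odd (f\<^sup>2)"
  proof -
    have "f\<^sup>2 = c\<^sup>2 + 2 * (d * b\<^sup>2)"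
      using ce fe by simp
    then show ?thesis
      using c by simp
  qed
  then have f: "odd f"
    by simp
  have "c\<^sup>2 < f\<^sup>2"
    using ce fe b by linarith
  then have "c < f"
    using power_less_imp_less_base by blast
  then obtain g where g: "f = c + g" "g > 0"
    using less_imp_add_positive by blast
  moreover from this f c have "even g"
    by simp
  ultimately obtain s where s: "f = c + 2 * s" "s > 0"
    by (auto elim!: evenE)
  \<comment> \<open>Now r = (f + c)/2 and s = (f - c)/2, so 2(r^2 + s^2) = c^2 + f^2 and 4rs = f^2 -
    c^2.\<close>
  define r where "r = c + s"
  have sq: "r\<^sup>2 + s\<^sup>2 = a\<^sup>2"
  proof -
    have "2 * (r\<^sup>2 + s\<^sup>2) = c\<^sup>2 + f\<^sup>2"
      by (simp add: s r_def power2_eq_square algebra_simps)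
    also have "\<dots> = 2 * a\<^sup>2"
      using ce fe by linarith
    finally show ?thesis
      by simp
  qed
  have "2 * (2 * (r * s)) + c\<^sup>2 = f\<^sup>2"
    by (simp add: s r_def power2_eq_square algebra_simps)
  then have rs: "2 * (r * s) = d * b\<^sup>2"
    using ce fe by linarith
  then have "even (d * b\<^sup>2)"
    by (metis dvd_triv_left)
  then have "even b"
    using d by simp
  then obtain x where "b = 2 * x" ..
  with rs have rsx: "r * s = 2 * (d * x\<^sup>2)"
    by (simp add: power_mult_distrib)
  have cop': "coprime r s"
  proof -
    have "gcd r s dvd c" "gcd r s dvd f"
    proof -
      show "gcd r s dvd c"
        by (metis r_def add_diff_cancel_right' dvd_diff_nat gcd_dvd1 gcd_dvd2)
      have "f = r + s"
        by (simp add: s r_def)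
      then show "gcd r s dvd f"
        by simp
    qed
    then show ?thesis
      using cop by (metis coprime_common_divisor coprime_iff_gcd_eq_1 is_unit_gcd)
  qed
  have pos: "r > 0" "s > 0"
    using s by (auto simp: r_def)
  note result = that
  \<comment> \<open>Either leg may be the even one, so the argument is stated for legs
    \<open>u\<close>, \<open>v\<close> with \<open>v\<close> even and then applied in both
    orders.\<close>
  have main: thesis
    if uv: "coprime u v" "even v" "u > 0" "v > 0" "u\<^sup>2 + v\<^sup>2 = a\<^sup>2" "u * v = 2 * (d * x\<^sup>2)" for u v :: nat
  proof -
    obtain P Q where PQ: "coprime P Q" "Q > 0" "odd (P + Q)" "u + Q\<^sup>2 = P\<^sup>2" "v = 2 * P * Q"
      "a = P\<^sup>2 + Q\<^sup>2"
      by (rule primitive_Pythagorean_triple[OF uv(1,2,4,5)])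
    have "Q\<^sup>2 < P\<^sup>2"
      using PQ(4) uv(3) by linarith
    then have QP: "Q < P"
      using power_less_imp_less_base by blast
    \<comment> \<open>Chain for the bound: P \<le> P^2 < P^2 + Q^2 = a \<le> a^2.\<close>
    have "P \<le> P\<^sup>2" "a \<le> a\<^sup>2"
      by (simp_all add: power2_eq_square)
    moreover have "0 < Q\<^sup>2"
      using PQ(2) by simp
    ultimately have "P < a\<^sup>2"
      using PQ(6) by linarith
    moreover have "u = (P - Q) * (P + Q)"
    proof -
      obtain w where "P = Q + w"
        using QP less_imp_add_positive by blast
      with PQ(4) show ?thesis
        by (simp add: power2_eq_square algebra_simps)
    qed
    then have "2 * (Q * P * ((P - Q) * (P + Q))) = 2 * (d * x\<^sup>2)"
      unfolding uv(6)[symmetric] PQ(5) by (simp only: ac_simps)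
    then have "Q * P * ((P - Q) * (P + Q)) = d * x\<^sup>2"
      by simp
    ultimately show thesis
      by (rule result[OF PQ(1,2) QP PQ(3)])
  qed
  have "even (r * s)"
    using rsx by simp
  then consider "even s" | "even r"
    by auto
  then show thesis
  proof cases
    case 1
    then show ?thesis
      using main[of r s] cop' pos sq rsx by simp
  next
    case 2
    then show ?thesis
      using main[of s r] cop' pos sq rsx by (simp add: coprime_commute add.commute mult.commute)
  qed
qed

section \<open>Infinite descent for m and e of opposite parity\<close>

lemma no_solution_opposite_parity:
  fixes d m e z :: nat
  assumes d: "prime d" and d1: "\<not> QuadRes (int d) (-1)" and d2: "\<not> QuadRes (int d) 2"
    and "coprime m e" "0 < e" "e < m" "odd (m + e)"
  shows "e * m * ((m - e) * (m + e)) \<noteq> d * z\<^sup>2"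
  using assms(4-)
proof (induction m arbitrary: e z rule: less_induct)
  case (less m)
  note cop = \<open>coprime m e\<close>
  have dint: "prime (int d)"
    using d by simp
  have sum_squares: "d dvd x \<and> d dvd y" if "x\<^sup>2 + y\<^sup>2 = d * w" for x y w :: nat
  proof -
    have "int d dvd (int x)\<^sup>2 - (-1) * (int y)\<^sup>2"
      using that by (metis diff_minus_eq_add dvd_triv_left mult_minus1 of_nat_add of_nat_mult of_nat_power)
    from nonresidue_dvd[OF dint d1 this] show ?thesis
      by simp
  qed
  have no_common: False if "d dvd m" "d dvd e"
    using that cop d by (metis coprime_common_divisor not_prime_unit)
  \<comment> \<open>Modulo 2, -1 is the square of 1. Oddness of \<open>d\<close> is what makes
    \<open>b\<close> even in the descent step.\<close>
  have "d \<noteq> 2"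
  proof
    assume "d = 2"
    have "[1\<^sup>2 = - 1] (mod (2 :: int))"
      by (simp add: cong_def)
    then have "QuadRes 2 (-1)"
      unfolding QuadRes_def ..
    with d1 \<open>d = 2\<close> show False
      by simp
  qed
  then have dodd: "odd d"
    using d by (metis primes_dvd_imp_eq two_is_prime_nat)
  obtain n where n: "m = e + n" "n > 0"
    using \<open>e < m\<close> less_imp_add_positive by blast
  have nodd: "odd n"
    using less.prems(4) n by auto
  have en: "coprime e n"
    using cop coprime_add_self_right_iff[of e n] n by (simp add: coprime_commute)
  have mn: "coprime m n"
    using en coprime_add_self_right_iff[of n e] n by (simp add: coprime_commute add.commute)
  have mp: "coprime m (m + e)" "coprime e (m + e)"
    using cop coprime_add_self_right_iff[of m e] coprime_add_self_right_iff[of e m]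
    by (simp_all add: coprime_commute add.commute)
  \<comment> \<open>Here opposite parity enters: m + e = n + 2e, and the factor 2 is harmless
    because \<open>n\<close> is odd.\<close>
  have np: "coprime n (m + e)"
  proof -
    have "coprime n (2 * e)"
      using en nodd by (simp add: coprime_commute)
    then have "coprime n (n + 2 * e)"
      by (simp only: coprime_add_self_right_iff)
    moreover have "n + 2 * e = m + e"
      using n by simp
    ultimately show ?thesis
      by simp
  qed
  show ?case
  proof
    assume "e * m * ((m - e) * (m + e)) = d * z\<^sup>2"
    then have eq: "(e * m) * (n * (m + e)) = d * z\<^sup>2"
      using n by simp
    have "coprime (e * m) (n * (m + e))"
      using en mn mp by simp
    from coprime_mult_eq_prime_square[OF d this eq] consider
      x y where "e * m = d * x\<^sup>2" "n * (m + e) = y\<^sup>2" |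
      x y where "e * m = x\<^sup>2" "n * (m + e) = d * y\<^sup>2"
      by blast
    then show False
    proof cases
      case (1 x y)
      from 1(2) np obtain c f where cf: "n = c\<^sup>2" "m + e = f\<^sup>2"
        by (metis coprime_mult_eq_square)
      from coprime_mult_eq_prime_square[OF d _ 1(1)] cop consider
        b a where "e = d * b\<^sup>2" "m = a\<^sup>2" | b a where "e = b\<^sup>2" "m = d * a\<^sup>2"
        by (auto simp: coprime_commute)
      then show False
      proof cases
        \<comment> \<open>Here c^2 = m - e, a^2 = m, f^2 = m + e and e = d b^2: the progression
          needed for the descent.\<close>
        case (1 b a)
        have "coprime c f"
          using np cf by simp
        moreover have "odd c"
          using nodd cf by simp
        ultimately obtain P Q x where "coprime P Q" "0 < Q" "Q < P" "odd (P + Q)" "P < a\<^sup>2"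
          "Q * P * ((P - Q) * (P + Q)) = d * x\<^sup>2"
          using descent_step[of c d b a f] 1 cf n \<open>0 < e\<close> dodd by (metis add.commute)
        with less.IH[of P Q x] 1 show False
          by simp
      next
        case (2 b a)
        have "c\<^sup>2 + b\<^sup>2 = d * a\<^sup>2"
          using 2 cf n by simp
        then have "d dvd b"
          using sum_squares by blast
        then show False
          using no_common 2 by (simp add: power2_eq_square)
      qed
    next
      case (2 x y)
      from 2(1) cop obtain b a where ba: "e = b\<^sup>2" "m = a\<^sup>2"
        by (metis coprime_commute coprime_mult_eq_square)
      from coprime_mult_eq_prime_square[OF d np 2(2)] consider
        c f where "n = d * c\<^sup>2" "m + e = f\<^sup>2" | c f where "n = c\<^sup>2" "m + e = d * f\<^sup>2"
        by blast
      then show False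
      proof cases
        case (1 c f)
        \<comment> \<open>This is (m + e) + (m - e) = 2m; modulo \<open>d\<close> it makes 2 a
          square unless \<open>d\<close> divides \<open>f\<close> and \<open>a\<close>.\<close>
        have "f\<^sup>2 + d * c\<^sup>2 = 2 * a\<^sup>2"
          using 1 ba n by simp
        then have "int (f\<^sup>2 + d * c\<^sup>2) = int (2 * a\<^sup>2)"
          by (simp only:)
        then have "(int f)\<^sup>2 - 2 * (int a)\<^sup>2 = int d * (- (int c)\<^sup>2)"
          by simp
        then have "int d dvd (int f)\<^sup>2 - 2 * (int a)\<^sup>2"
          by simp
        from nonresidue_dvd[OF dint d2 this] have "d dvd f" "d dvd a"
          by simp_all
        then have "d dvd m" "d dvd m + e"
          using 1 ba by (simp_all add: power2_eq_square)
        then show False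
          using no_common by (simp add: dvd_add_right_iff)
      next
        case (2 c f)
        have "a\<^sup>2 + b\<^sup>2 = d * f\<^sup>2"
          using 2 ba by simp
        then have "d dvd a" "d dvd b"
          using sum_squares by blast+
        then show False
          using no_common ba by (simp add: power2_eq_square)
      qed
    qed
  qed
qed

section \<open>From the rational equation to the integer one\<close>

text \<open>Once k/w is in lowest terms, the square of the reduced \<open>k\<close> divides
  \<open>d\<close>, which is squarefree, so the reduced \<open>k\<close> is 1. This removes first
  the factor \<open>k\<^sup>2\<close> of the rational equation and later a factor 4.\<close>

lemma cancel_square_prime:
  fixes N k d w :: nat
  assumes d: "prime d" and k: "k > 0" and eq: "N * k\<^sup>2 = d * w\<^sup>2"
  obtains z where "N = d * z\<^sup>2"
proof -
  define g where "g = gcd k w"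
  obtain k' w' where kw: "k = k' * g" "w = w' * g" "coprime k' w'"
    using k gcd_coprime_exists[of k w] unfolding g_def by auto
  have g: "g > 0"
    using k by (simp add: g_def)
  have eq': "N * k'\<^sup>2 = d * w'\<^sup>2"
    using eq g by (simp add: kw power_mult_distrib flip: mult.assoc)
  have "k'\<^sup>2 dvd d"
    using eq' kw(3) by (metis coprime_dvd_mult_left_iff coprime_power_left_iff
        coprime_power_right_iff dvd_triv_right)
  then obtain q where "d = k'\<^sup>2 * q" ..
  then have q: "d = k' * (k' * q)"
    by (simp add: power2_eq_square)
  have "k' = 1"
  proof (rule ccontr)
    assume "k' \<noteq> 1"
    moreover have "k' dvd d"
      using q by simp
    ultimately have "k' = d"
      using d by (auto simp: prime_nat_iff)
    with q d have "k' * q = 1"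
      by (simp add: prime_gt_0_nat)
    with \<open>k' \<noteq> 1\<close> show False
      by simp
  qed
  with eq' have "N = d * w'\<^sup>2"
    by simp
  then show ?thesis
    by (rule that)
qed

theorem theorem1:
  fixes d :: nat
  assumes "prime d" and "d > 3"
    and "\<not> QuadRes (int d) (-1)"
    and "\<not> QuadRes (int d) 2"
  shows "\<not> (\<exists>k j m e :: nat.
    j > 0 \<and> coprime m e \<and> coprime k j \<and> m > e \<and> e > 0 \<and>
    real d = (real k / (2 * real j))\<^sup>2 * (((real m)\<^sup>2 - (real e)\<^sup>2) / (real e * real m)))"
proof clarify
  fix k j m e :: nat
  assume j: "j > 0" and cop: "coprime m e" and em: "m > e" "e > 0"
    and eq: "real d = (real k / (2 * real j))\<^sup>2 * (((real m)\<^sup>2 - (real e)\<^sup>2) / (real e * real m))"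
  have k: "k > 0"
    using eq \<open>d > 3\<close> by (cases "k = 0") auto
  have *: "(real k)\<^sup>2 * ((real m)\<^sup>2 - (real e)\<^sup>2) = real d * (2 * real j)\<^sup>2 * (real e * real m)"
    using j em eq by (simp add: power_divide)
  \<comment> \<open>Multiplying the cleared equation by em turns its right side into
    \<open>d\<close> times a square.\<close>
  have "real (e * m * ((m - e) * (m + e)) * k\<^sup>2) =
      real e * real m * ((real k)\<^sup>2 * ((real m)\<^sup>2 - (real e)\<^sup>2))"
  proof -
    have "real ((m - e) * (m + e)) = (real m)\<^sup>2 - (real e)\<^sup>2"
      unfolding of_nat_mult of_nat_diff[OF less_imp_le[OF em(1)]] of_nat_add
      by (simp add: power2_eq_square algebra_simps)
    then show ?thesis
      by simp
  qed
  also have "\<dots> = real (d * (2 * j * (e * m))\<^sup>2)"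
    unfolding * by (simp add: power2_eq_square)
  finally have "real (e * m * ((m - e) * (m + e)) * k\<^sup>2) = real (d * (2 * j * (e * m))\<^sup>2)" .
  then have "e * m * ((m - e) * (m + e)) * k\<^sup>2 = d * (2 * j * (e * m))\<^sup>2"
    by (simp only: of_nat_eq_iff)
  from cancel_square_prime[OF assms(1) k this]
  obtain z where z: "e * m * ((m - e) * (m + e)) = d * z\<^sup>2" .
  note no_sol = no_solution_opposite_parity[OF assms(1,3,4)]
  show False
  proof (cases "odd (m + e)")
    case True
    then show False
      using no_sol[OF cop em(2,1)] z by blast
  next
    case False
    obtain n where n: "m = e + n" "n > 0"
      using em less_imp_add_positive by blast
    with False have "even n"
      by auto
    then obtain v where v: "n = 2 * v" ..
    have eodd: "odd e"
      using False cop by (metis coprime_common_divisor even_add odd_one)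
    \<comment> \<open>For odd \<open>m\<close> and \<open>e\<close>, u = (m + e)/2 and v = (m - e)/2
      have odd sum \<open>m\<close>. Passing to (u, v) divides the product by 4, since 2u, 2v, u + v
      and u - v are the four old factors.\<close>
    define u where "u = e + v"
    have mu: "m = u + v" "v < u" "0 < v" "e = u - v"
      using n v em by (auto simp: u_def)
    have "coprime u v"
    proof -
      have "coprime e n"
        using cop coprime_add_self_right_iff[of e n] n by (simp add: coprime_commute)
      then have "coprime v e"
        using v by (simp add: coprime_commute)
      then show ?thesis
        using coprime_add_self_right_iff[of v e] by (simp add: u_def coprime_commute add.commute)
    qed
    moreover have "odd (u + v)"
      using eodd by (simp add: u_def)
    moreover have "v * u * ((u - v) * (u + v)) * 2\<^sup>2 = d * z\<^sup>2"
      using z by (simp add: n v u_def power2_eq_square algebra_simps)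
    then obtain z' where "v * u * ((u - v) * (u + v)) = d * z'\<^sup>2"
      by (rule cancel_square_prime[OF assms(1), rotated]) auto
    ultimately show False
      using no_sol mu by blast
  qed
qed

end
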